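(* Let $r\ge 2$, let $P_1,\dots,P_{3^{r-1}}$ be all the collectable $r$-patterns, and let $a_1,\dots,a_{3^{r-1}}$ be positive integers. If $n\ge\prod_{i=1}^{3^{r-1}}a_i+1$, then (a) every ordered $r$-matching of size $n$ contains a $P_i$-clique of size greater than $a_i2^{-m(P_i)}$, for some $i\in[3^{r-1}]$; (b) every clean ordered $r$-matching of size $n$ contains a $P_i$-clique of size at least $a_i+1$, for some $i\in[3^{r-1}]$.
   Context: An ordered $r$-matching of size $n$ is a set of $n$ pairwise disjoint $r$-element subsets (edges) of the linearly ordered set $[rn]=\{1,\dots,rn\}$ covering $[rn]$ (more generally, of any finite linearly ordered vertex set; two ordered matchings are identified if they are order-isomorphic). A matching is represented by a word $w_1\cdots w_{rn}$ in which $w_i=w_j$ iff $i,j$ lie in the same edge; words differing by a renaming of letters represent the same matching. An $r$-pattern is an ordered $r$-matching of size two, written as a word in letters $A,B$ each occurring $r$ times (e.g. $AABB$, $ABBA$, $ABAB$ for $r=2$). Two edges $e,f$ of a matching form pattern $P$ if the sub-matching $\{e,f\}$ (with the induced order on $e\cup f$) is order-isomorphic to $P$. A $P$-clique is a matching in which every pair of edges forms $P$; by convention a single edge is a $P$-clique for every $P$. A pattern $P$ is collectable if for every $k\ge2$ there exists a $P$-clique of size $k$. A run is a maximal block of consecutive equal letters in a word; the maturity $m(P)$ of a collectable pattern $P$ is the length of the last maximal run of its word minus $2$, or $0$ if this number is negative. A matching is clean if every pair of its edges forms a collectable pattern. A $P$-clique contained in a matching $M$ means a sub-matching of $M$ (with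 the induced order) which is a $P$-clique. *)

theory Defs
  imports Complex_Main "HOL-Library.Disjoint_Sets"
begin

text \<open>Matchings are taken on arbitrary finite linearly ordered vertex sets \<open>V\<close>, with
  \<open>V = {1..r * n}\<close> as the standard case; the size of a matching \<open>M\<close> is \<open>card M\<close>.\<close>

definition ordered_matching :: "nat \<Rightarrow> 'a::linorder set \<Rightarrow> 'a set set \<Rightarrow> bool" where
  "ordered_matching r V M \<longleftrightarrow> finite V \<and> partition_on V M \<and> (\<forall>e\<in>M. card e = r)"

definition order_isomorphic :: "'a::linorder set set \<Rightarrow> 'b::linorder set set \<Rightarrow> bool" where
  "order_isomorphic M N \<longleftrightarrow> (\<exists>\<phi>. strict_mono_on (\<Union>M) \<phi> \<and> (\<lambda>e. \<phi> ` e) ` M = N)"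

text \<open>Every order-isomorphism class of matchings of size two has exactly one representative with
  vertex set \<open>{1..2 * r}\<close>, so on this vertex set distinct patterns are distinct as sets.\<close>

definition pattern :: "nat \<Rightarrow> nat set set \<Rightarrow> bool" where
  "pattern r P \<longleftrightarrow> ordered_matching r {1..2 * r} P \<and> card P = 2"

definition forms_pattern :: "'a::linorder set \<Rightarrow> 'a set \<Rightarrow> nat set set \<Rightarrow> bool" where
  "forms_pattern e f P \<longleftrightarrow> order_isomorphic {e, f} P"

definition clique :: "nat \<Rightarrow> nat set set \<Rightarrow> 'a::linorder set set \<Rightarrow> bool" where
  "clique r P C \<longleftrightarrow> ordered_matching r (\<Union>C) C \<and> (\<forall>e\<in>C. \<forall>f\<in>C. e \<noteq> f \<longrightarrow> forms_pattern e f P)"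

text \<open>Up to order isomorphism every finite linearly ordered vertex set is a set of natural numbers.\<close>

definition collectable :: "nat \<Rightarrow> nat set set \<Rightarrow> bool" where
  "collectable r P \<longleftrightarrow> pattern r P \<and> (\<forall>k\<ge>2. \<exists>C :: nat set set. clique r P C \<and> card C = k)"

definition clean :: "nat \<Rightarrow> 'a::linorder set set \<Rightarrow> bool" where
  "clean r M \<longleftrightarrow> (\<forall>e\<in>M. \<forall>f\<in>M. e \<noteq> f \<longrightarrow> (\<exists>P. collectable r P \<and> forms_pattern e f P))"

text \<open>The word of a matching uses the edges themselves as letters.\<close>

definition matching_word :: "'a::linorder set set \<Rightarrow> 'a set list" where
  "matching_word M = map (\<lambda>v. THE e. e \<in> M \<and> v \<in> e) (sorted_list_of_set (\<Union>M))"

definition last_run_length :: "'b list \<Rightarrow> nat" where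
  "last_run_length w = length (takeWhile (\<lambda>x. x = last w) (rev w))"

text \<open>Truncated subtraction on \<^typ>\<open>nat\<close> is intended.\<close>

definition maturity :: "nat set set \<Rightarrow> nat" where
  "maturity P = last_run_length (matching_word P) - 2"

end

theory Submission imports Defs begin

text \<open>A collectable pattern is encoded by \<open>r - 1\<close> steps: passing from the \<open>i\<close>-th to the next
  vertices of two edges, either the current block is continued (\<open>Join\<close>), or a new block
  starts in which the edge with the smaller first vertex comes first (\<open>Up\<close>) or second
  (\<open>Down\<close>). The \<open>3 ^ (r - 1)\<close> codes give distinct collectable patterns, hence, by the
  bijection in the hypothesis, all of them.

  The cliques are found by induction on the length of the prefixes of the edges. Given a clique for
  the prefixes ending at the \<open>m\<close>-th vertices, order its edges by these vertices. The edge pairs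
  whose next vertices come in the opposite order form a partial order; so do the pairs with
  \<open>e\<^bsub>m+1\<^esub> < f\<^bsub>m\<^esub>\<close>, which continue the block. Two applications of Mirsky's theorem thus split the
  weight into three factors, one per step. A chain of the second order need not form a full block,
  as only consecutive positions are separated, but every other edge of it does. This halving is
  needed only when a block reaches length three or more, whence the exponent given by the maturity,
  and it is not needed at all in a clean matching.\<close>

section \<open>Codes of collectable patterns\<close>

datatype step = Join | Up | Down

fun block :: "(nat \<Rightarrow> step) \<Rightarrow> nat \<Rightarrow> nat" where
  "block s 0 = 0"
| "block s (Suc i) = (if s i = Join then block s i else Suc (block s i))"

text \<open>The value \<open>True\<close> at 0 is a normalization: pairs of edges are always listed
  by increasing first vertex.\<close>

fun upward :: "(nat \<Rightarrow> step) \<Rightarrow> nat \<Rightarrow> bool" where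
  "upward s 0 = True"
| "upward s (Suc i) = (if s i = Join then upward s i else s i = Up)"

text \<open>Only positions up to \<open>i\<close> are counted, so this is the length the current
  block has reached so far.\<close>

fun block_length :: "(nat \<Rightarrow> step) \<Rightarrow> nat \<Rightarrow> nat" where
  "block_length s 0 = 1"
| "block_length s (Suc i) = (if s i = Join then Suc (block_length s i) else 1)"

text \<open>The prescribed truth value of "vertex \<open>i\<close> of the first edge lies below
  vertex \<open>j\<close> of the second". Within a block all vertices of the leading edge precede
  all those of the other.\<close>

definition code_less :: "(nat \<Rightarrow> step) \<Rightarrow> nat \<Rightarrow> nat \<Rightarrow> bool" where
  "code_less s i j \<longleftrightarrow> block s i < block s j \<or> block s i = block s j \<and> upward s i"

definition codes :: "nat \<Rightarrow> (nat \<Rightarrow> step) set" where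
  "codes m = {..<m} \<rightarrow>\<^sub>E UNIV"

lemma UNIV_step: "(UNIV :: step set) = {Join, Up, Down}"
  using step.exhaust by auto

lemma card_codes: "card (codes m) = 3 ^ m"
  unfolding codes_def by (simp add: card_PiE UNIV_step numeral_3_eq_3)

lemma block_mono: "i \<le> j \<Longrightarrow> block s i \<le> block s j"
  by (rule lift_Suc_mono_le[of "block s"]) auto

lemma block_cong: "(\<And>k. k < i \<Longrightarrow> s k = t k) \<Longrightarrow> block s i = block t i"
  by (induction i) auto

lemma upward_cong: "(\<And>k. k < i \<Longrightarrow> s k = t k) \<Longrightarrow> upward s i = upward t i"
  by (induction i) auto

lemma block_length_cong: "(\<And>k. k < i \<Longrightarrow> s k = t k) \<Longrightarrow> block_length s i = block_length t i"
  by (induction i) auto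

lemma code_less_cong:
  assumes "\<And>k. k < m \<Longrightarrow> s k = t k" "i \<le> m" "j \<le> m"
  shows "code_less s i j = code_less t i j"
  unfolding code_less_def
  using block_cong[of i s t] block_cong[of j s t] upward_cong[of i s t] assms by simp

lemma upward_eq_if_block_eq:
  assumes "block s i = block s j" shows "upward s i = upward s j"
proof -
  have *: "upward s j = upward s i" if "i \<le> j" "block s i = block s j" for i j
    using that
  proof (induction j rule: dec_induct)
    case (step j)
    then show ?case using block_mono[of i j s] by (auto split: if_splits)
  qed simp
  show ?thesis using *[of i j] *[of j i] assms by (metis nat_le_linear)
qed

lemma block_length_pos: "0 < block_length s i"
  by (cases i) auto

lemma block_length_le: "block_length s i \<le> Suc i"
  by (induction i) auto

text \<open>Blocks are intervals of positions, so the block of \<open>j\<close>, cut off at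
  \<open>j\<close>, consists of the last \<open>block_length s j\<close> positions. This later links
  block lengths to runs of the word.\<close>

lemma block_eq_iff_block_length:
  "i \<le> j \<Longrightarrow> block s i = block s j \<longleftrightarrow> j < i + block_length s j"
proof (induction j)
  case (Suc j)
  show ?case
  proof (cases "i = Suc j")
    case True
    then show ?thesis using block_length_pos[of s "Suc j"] by (simp del: block_length.simps)
  next
    case False
    then show ?thesis using Suc block_mono[of i j s] by auto
  qed
qed simp

text \<open>Inside a block, one edge has both vertices below both vertices of the other; across a
  block boundary each vertex \<open>i\<close> is below the opposite vertex \<open>Suc i\<close>.
  Hence a code can be read back from the comparisons.\<close>

lemma step_from_code_less:
  "s i = (if code_less s (Suc i) i \<or> \<not> code_less s i (Suc i) then Join
          else if code_less s (Suc i) (Suc i) then Up else Down)"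
  by (cases "s i") (auto simp: code_less_def)

lemma code_eq_if_code_less_eq:
  assumes "\<And>i j. i \<le> m \<Longrightarrow> j \<le> m \<Longrightarrow> code_less s i j = code_less t i j" "k < m"
  shows "s k = t k"
  using step_from_code_less[of s k] step_from_code_less[of t k] assms by simp

lemma prod_codes_Suc:
  fixes a :: "(nat \<Rightarrow> step) \<Rightarrow> real"
  shows "prod a (codes (Suc m)) = (\<Prod>s\<in>codes m. a (s(m := Join)) * a (s(m := Up)) * a (s(m := Down)))"
proof -
  have "codes (Suc m) = (\<lambda>(t, s). s(m := t)) ` (UNIV \<times> codes m)"
    unfolding codes_def lessThan_Suc by (simp add: PiE_insert_eq)
  moreover have "inj_on (\<lambda>(t, s). s(m := t)) (UNIV \<times> codes m)"
    unfolding codes_def by (rule inj_combinator) simp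
  ultimately have "prod a (codes (Suc m)) = (\<Prod>(t, s)\<in>UNIV \<times> codes m. a (s(m := t)))"
    by (simp add: prod.reindex o_def case_prod_unfold)
  also have "\<dots> = (\<Prod>t\<in>UNIV. \<Prod>s\<in>codes m. a (s(m := t)))"
    by (simp add: prod.cartesian_product)
  also have "\<dots> = (\<Prod>s\<in>codes m. a (s(m := Join)) * a (s(m := Up)) * a (s(m := Down)))"
    by (simp add: UNIV_step prod.distrib mult.assoc)
  finally show ?thesis .
qed

lemma fun_upd_in_codes: "s \<in> codes m \<Longrightarrow> s(m := t) \<in> codes (Suc m)"
  unfolding codes_def lessThan_Suc by (auto intro!: PiE_fun_upd)

section \<open>Chains and antichains\<close>

text \<open>Induction on \<open>k\<close>, peeling off the antichain of \<open>R\<close>-maximal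
  elements, which lowers the bound on chains by one. Since \<open>key\<close> linearly extends
  \<open>R\<close>, chains can be described through it.\<close>

lemma Mirsky_bound:
  fixes key :: "'b \<Rightarrow> 'a::linorder" and \<beta> :: real
  assumes "finite C" "inj_on key C"
    and "\<And>e f. \<lbrakk>e \<in> C; f \<in> C; R e f\<rbrakk> \<Longrightarrow> key e < key f"
    and "\<And>e f g. \<lbrakk>e \<in> C; f \<in> C; g \<in> C; R e f; R f g\<rbrakk> \<Longrightarrow> R e g"
    and "\<And>D. \<lbrakk>D \<subseteq> C; \<forall>e\<in>D. \<forall>f\<in>D. key e < key f \<longrightarrow> R e f\<rbrakk> \<Longrightarrow> card D \<le> k"
    and "\<And>D. \<lbrakk>D \<subseteq> C; \<forall>e\<in>D. \<forall>f\<in>D. \<not> R e f\<rbrakk> \<Longrightarrow> real (card D) \<le> \<beta>"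
  shows "real (card C) \<le> real k * \<beta>"
  using assms
proof (induction k arbitrary: C)
  case 0
  have "C = {}"
  proof (rule ccontr)
    assume "C \<noteq> {}"
    then obtain e where "e \<in> C" by blast
    then show False using "0.prems"(5)[of "{e}"] by auto
  qed
  then show ?case by simp
next
  case (Suc k)
  define A where "A = {e \<in> C. \<forall>f\<in>C. \<not> R e f}"
  have bound: "card D \<le> k" if D: "D \<subseteq> C - A" "\<forall>e\<in>D. \<forall>f\<in>D. key e < key f \<longrightarrow> R e f" for D
  proof (cases "D = {}")
    case False
    have fin: "finite D" using D(1) Suc.prems(1) by (meson Diff_subset finite_subset)
    \<comment> \<open>The top \<open>d\<close> of the chain is not maximal in \<open>C\<close>, so
      some \<open>f\<close> above it extends the chain to a longer one in \<open>C\<close>.\<close>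
    obtain d where d: "d \<in> D" "\<forall>e\<in>D. key e \<le> key d"
      using Max_in[of "key ` D"] Max_ge[of "key ` D"] False fin by fastforce
    then obtain f where f: "f \<in> C" "R d f" using D(1) unfolding A_def by auto
    have sub: "d \<in> C" "\<And>e. e \<in> D \<Longrightarrow> e \<in> C" using D(1) d by auto
    have df: "key d < key f" using Suc.prems(3)[of d f] f sub by simp
    have ef: "R e f" "key e < key f" if "e \<in> D" for e
    proof -
      have "e = d \<or> R e d"
        using d that D(2) Suc.prems(2) sub by (metis inj_onD order_le_less)
      then show "R e f" using f sub that Suc.prems(4)[of e d f] by auto
      show "key e < key f" using df d that by (meson le_less_trans)
    qed
    have "card (insert f D) \<le> Suc k"
    proof (rule Suc.prems(5))
      show "insert f D \<subseteq> C" using f D by auto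
      show "\<forall>e\<in>insert f D. \<forall>g\<in>insert f D. key e < key g \<longrightarrow> R e g"
        using ef D(2) by (auto dest: less_asym)
    qed
    moreover have "f \<notin> D" using ef(2) by blast
    ultimately show ?thesis using fin by simp
  qed simp
  have "real (card (C - A)) \<le> real k * \<beta>"
  proof (rule Suc.IH)
    show "finite (C - A)" using Suc.prems(1) by simp
    show "inj_on key (C - A)" using Suc.prems(2) by (rule inj_on_diff)
    show "\<And>e f. \<lbrakk>e \<in> C - A; f \<in> C - A; R e f\<rbrakk> \<Longrightarrow> key e < key f" using Suc.prems(3) by blast
    show "\<And>e f g. \<lbrakk>e \<in> C - A; f \<in> C - A; g \<in> C - A; R e f; R f g\<rbrakk> \<Longrightarrow> R e g"
      using Suc.prems(4) by blast
    show "\<And>D. \<lbrakk>D \<subseteq> C - A; \<forall>e\<in>D. \<forall>f\<in>D. \<not> R e f\<rbrakk> \<Longrightarrow> real (card D) \<le> \<beta>"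
      using Suc.prems(6) by blast
  qed (rule bound)
  moreover have "real (card A) \<le> \<beta>"
    by (rule Suc.prems(6)) (auto simp: A_def)
  moreover have "card C = card (C - A) + card A"
    using Suc.prems(1) by (metis (no_types, lifting) A_def card_Diff_subset card_mono
        finite_subset le_add_diff_inverse2 mem_Collect_eq subsetI)
  ultimately show ?case by (simp add: algebra_simps)
qed

lemma chain_or_antichain:
  fixes key :: "'b \<Rightarrow> 'a::linorder" and \<alpha> \<beta> :: real
  assumes "finite C" "inj_on key C"
    and "\<And>e f. \<lbrakk>e \<in> C; f \<in> C; R e f\<rbrakk> \<Longrightarrow> key e < key f"
    and "\<And>e f g. \<lbrakk>e \<in> C; f \<in> C; g \<in> C; R e f; R f g\<rbrakk> \<Longrightarrow> R e g"
    and "0 \<le> \<alpha>" "\<alpha> * \<beta> < real (card C)"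
  obtains (chain) D where "D \<subseteq> C" "\<forall>e\<in>D. \<forall>f\<in>D. key e < key f \<longrightarrow> R e f" "\<alpha> < real (card D)"
  | (antichain) D where "D \<subseteq> C" "\<forall>e\<in>D. \<forall>f\<in>D. \<not> R e f" "\<beta> < real (card D)"
proof (rule ccontr)
  assume none: "\<not> thesis"
  \<comment> \<open>Chain lengths are integers, so the real bound may be rounded down to fit the
    induction over naturals.\<close>
  have ch: "card D \<le> nat \<lfloor>\<alpha>\<rfloor>" if "D \<subseteq> C" "\<forall>e\<in>D. \<forall>f\<in>D. key e < key f \<longrightarrow> R e f" for D
    using none chain[OF that] by (force simp: not_less intro: le_nat_floor)
  have an: "real (card D) \<le> \<beta>" if "D \<subseteq> C" "\<forall>e\<in>D. \<forall>f\<in>D. \<not> R e f" for D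
    using none antichain[OF that] by force
  have "real (card C) \<le> real (nat \<lfloor>\<alpha>\<rfloor>) * \<beta>"
    by (rule Mirsky_bound[where key = key and R = R]) (use assms(1-4) ch an in blast)+
  \<comment> \<open>The empty antichain supplies the sign needed to replace the floor by
    \<open>\<alpha>\<close> in the product.\<close>
  moreover have "0 \<le> \<beta>" using an[of "{}"] by simp
  ultimately have "real (card C) \<le> \<alpha> * \<beta>"
    using assms(5) by (meson mult_right_mono of_nat_floor order_trans)
  then show False using assms(6) by simp
qed

text \<open>Split \<open>C\<close> by the parity of the rank and keep the larger class. Neighbours
  in the order have ranks differing by exactly one, so two elements of the same class are never
  neighbours.\<close>

lemma every_other:
  fixes key :: "'b \<Rightarrow> 'a::linorder"
  assumes "finite C" "inj_on key C"
  obtains D where "D \<subseteq> C" "real (card C) / 2 \<le> real (card D)"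
    "\<And>e g. \<lbrakk>e \<in> D; g \<in> D; key e < key g\<rbrakk> \<Longrightarrow> \<exists>f\<in>C. key e < key f \<and> key f < key g"
proof -
  define rank where "rank e = card {h \<in> C. key h < key e}" for e
  have between: "\<exists>f\<in>C. key e < key f \<and> key f < key g"
    if "e \<in> C" "g \<in> C" "key e < key g" "even (rank e) = even (rank g)" for e g
  proof (rule ccontr)
    assume none: "\<not> ?thesis"
    have "{h \<in> C. key h < key g} = insert e {h \<in> C. key h < key e}"
    proof
      show "{h \<in> C. key h < key g} \<subseteq> insert e {h \<in> C. key h < key e}"
      proof
        fix h assume h: "h \<in> {h \<in> C. key h < key g}"
        then have "\<not> key e < key h" using none by auto
        then show "h \<in> insert e {h \<in> C. key h < key e}"
          using h \<open>e \<in> C\<close> assms(2) by (auto simp: not_less order_le_less dest: inj_onD)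
      qed
    qed (use that in auto)
    then have "rank g = Suc (rank e)" using assms(1) by (simp add: rank_def)
    then show False using that(4) by simp
  qed
  define E where "E = {e \<in> C. even (rank e)}"
  have "card C = card E + card (C - E)"
    using assms(1) by (metis (no_types, lifting) E_def card_Diff_subset card_mono finite_subset
        le_add_diff_inverse mem_Collect_eq subsetI)
  then consider "real (card C) / 2 \<le> card E" | "real (card C) / 2 \<le> card (C - E)" by linarith
  then show ?thesis
  proof cases
    case 1
    then show ?thesis using that[of E] between unfolding E_def by blast
  next
    case 2
    then show ?thesis using that[of "C - E"] between unfolding E_def by blast
  qed
qed

section \<open>Cliques described by codes\<close>

definition follows :: "(nat \<Rightarrow> step) \<Rightarrow> nat \<Rightarrow> (nat \<Rightarrow> 'a::linorder) \<Rightarrow> (nat \<Rightarrow> 'a) \<Rightarrow> bool" where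
  "follows s m u v \<longleftrightarrow> (\<forall>i\<le>m. \<forall>j\<le>m. u i < v j \<longleftrightarrow> code_less s i j)"

lemma follows_unique:
  assumes "follows s m u v" "follows t m u v" "k < m"
  shows "s k = t k"
proof (rule code_eq_if_code_less_eq[OF _ assms(3)])
  show "code_less s i j = code_less t i j" if "i \<le> m" "j \<le> m" for i j
    using that assms(1,2) unfolding follows_def by metis
qed

lemma follows_cong:
  assumes "\<And>k. k < m \<Longrightarrow> s k = t k"
  shows "follows s m u v = follows t m u v"
proof -
  have "code_less s i j = code_less t i j" if "i \<le> m" "j \<le> m" for i j
    using assms that by (rule code_less_cong)
  then show ?thesis unfolding follows_def by simp
qed

lemma follows_mono: "follows s n u v \<Longrightarrow> m \<le> n \<Longrightarrow> follows s m u v"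
  unfolding follows_def by auto

text \<open>Separation is assumed only against the \<open>m\<close>-th vertices; monotonicity
  carries it down to all earlier ones. The order of the two new vertices then decides between
  \<open>Up\<close> and \<open>Down\<close>.\<close>

lemma follows_break:
  assumes fol: "follows s m u v"
    and u: "\<And>i j. i < j \<Longrightarrow> j \<le> Suc m \<Longrightarrow> u i < u j"
    and v: "\<And>i j. i < j \<Longrightarrow> j \<le> Suc m \<Longrightarrow> v i < v j"
    and t: "t \<noteq> Join" "u (Suc m) < v (Suc m) \<longleftrightarrow> t = Up"
    and sep: "u m < v (Suc m)" "v m < u (Suc m)"
  shows "follows (s(m := t)) (Suc m) u v"
  unfolding follows_def
proof (intro allI impI)
  fix i j assume ij: "i \<le> Suc m" "j \<le> Suc m"
  have cong: "code_less (s(m := t)) i j = code_less s i j" if "i \<le> m" "j \<le> m"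
    using that by (intro code_less_cong[of m]) auto
  have lt: "block (s(m := t)) k < block (s(m := t)) (Suc m)" if "k \<le> m" for k
    using block_mono[OF that, of "s(m := t)"] t(1) by simp
  have uk: "u k < v (Suc m)" "v k < u (Suc m)" if "k \<le> m" for k
    using sep u[of k m] v[of k m] that by (cases "k = m"; force)+
  consider "i \<le> m" "j \<le> m" | "i \<le> m" "j = Suc m" | "i = Suc m" "j \<le> m" | "i = Suc m" "j = Suc m"
    using ij by linarith
  then show "u i < v j \<longleftrightarrow> code_less (s(m := t)) i j"
  proof cases
    case 1
    then show ?thesis using cong fol by (simp add: follows_def)
  next
    case 2
    then show ?thesis using lt uk unfolding code_less_def by simp
  next
    case 3
    then show ?thesis using lt[of j] uk[of j] unfolding code_less_def by auto
  next
    case 4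
    then show ?thesis using t unfolding code_less_def by simp
  qed
qed

text \<open>Only the new vertex of the leading edge needs a hypothesis: it must stay below the other
  edge's vertices of the current block. All remaining comparisons with new vertices follow from old
  ones by monotonicity.\<close>

lemma follows_join:
  assumes fol: "follows s m u v"
    and u: "\<And>i j. i < j \<Longrightarrow> j \<le> Suc m \<Longrightarrow> u i < u j"
    and v: "\<And>i j. i < j \<Longrightarrow> j \<le> Suc m \<Longrightarrow> v i < v j"
    and disj: "\<And>i j. i \<le> Suc m \<Longrightarrow> j \<le> Suc m \<Longrightarrow> u i \<noteq> v j"
    and join: "\<And>i. i \<le> m \<Longrightarrow> block s i = block s m \<Longrightarrow>
      (if upward s m then u (Suc m) < v i else v (Suc m) < u i)"
  shows "follows (s(m := Join)) (Suc m) u v"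
  unfolding follows_def
proof (intro allI impI)
  let ?t = "s(m := Join)"
  fix i j assume ij: "i \<le> Suc m" "j \<le> Suc m"
  have cong: "code_less ?t i j = code_less s i j" if "i \<le> m" "j \<le> m" for i j
    using that by (intro code_less_cong[of m]) auto
  have blk: "block ?t k = block s k" "upward ?t k = upward s k" if "k \<le> m" for k
    using that by (intro block_cong upward_cong; auto)+
  have blkS: "block ?t (Suc m) = block s m" "upward ?t (Suc m) = upward s m"
    using blk[of m] by simp_all
  have less: "u i < v j \<longleftrightarrow> code_less s i j" "v j < u i \<longleftrightarrow> \<not> code_less s i j" if "i \<le> m" "j \<le> m" for i j
  proof -
    show "u i < v j \<longleftrightarrow> code_less s i j" using that fol unfolding follows_def by blast
    then show "v j < u i \<longleftrightarrow> \<not> code_less s i j" using that disj[of i j] by auto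
  qed
  have um: "u m < u (Suc m)" "v m < v (Suc m)" using u v by auto
  have ks: "block s k = block s m \<or> block s k < block s m" if "k \<le> m" for k
    using block_mono[OF that, of s] by linarith
  consider "i \<le> m" "j \<le> m" | "i \<le> m" "j = Suc m" | "i = Suc m" "j \<le> m" | "i = Suc m" "j = Suc m"
    using ij by linarith
  then show "u i < v j \<longleftrightarrow> code_less ?t i j"
  proof cases
    case 1
    then show ?thesis using cong less by simp
  next
    case 2
    have eq: "code_less ?t i (Suc m) = code_less s i m"
      using 2 blk blkS by (simp add: code_less_def)
    show ?thesis
    proof (cases "code_less s i m")
      case True
      then show ?thesis using 2 eq less[of i m] um by (auto intro: less_trans)
    next
      case False
      then have "block s i = block s m" "\<not> upward s i"
        using ks[of i] 2 by (auto simp: code_less_def)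
      then have "v (Suc m) < u i" using join[of i] 2 upward_eq_if_block_eq[of s i m] by simp
      then show ?thesis using 2 eq False by auto
    qed
  next
    case 3
    have eq: "code_less ?t (Suc m) j = code_less s m j"
      using 3 blk blkS by (simp add: code_less_def)
    show ?thesis
    proof (cases "code_less s m j")
      case True
      then have "block s j = block s m" "upward s m"
        using ks[of j] 3 by (auto simp: code_less_def)
      then show ?thesis using join[of j] 3 eq True by simp
    next
      case False
      then have "v j < u (Suc m)" using 3 less[of m j] um by (auto intro: less_trans)
      then show ?thesis using 3 eq False by auto
    qed
  next
    case 4
    have eq: "code_less ?t (Suc m) (Suc m) = upward s m"
      using blkS by (simp add: code_less_def)
    show ?thesis
      using 4 eq join[of m] um by (auto split: if_splits)
  qed
qed

section \<open>Growing cliques one vertex position at a time\<close>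

locale vertex_array =
  fixes M :: "'b set" and x :: "'b \<Rightarrow> nat \<Rightarrow> 'a::linorder" and r :: nat
  assumes finite_M: "finite M"
    and mono_x: "\<lbrakk>e \<in> M; i < j; j < r\<rbrakk> \<Longrightarrow> x e i < x e j"
    and disjoint_x: "\<lbrakk>e \<in> M; f \<in> M; e \<noteq> f; i < r; j < r\<rbrakk> \<Longrightarrow> x e i \<noteq> x f j"
begin

definition code_clique :: "(nat \<Rightarrow> step) \<Rightarrow> nat \<Rightarrow> 'b set \<Rightarrow> bool" where
  "code_clique s m C \<longleftrightarrow> (\<forall>e\<in>C. \<forall>f\<in>C. x e 0 < x f 0 \<longrightarrow> follows s m (x e) (x f))"

lemma code_clique_subset: "code_clique s m C \<Longrightarrow> D \<subseteq> C \<Longrightarrow> code_clique s m D"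
  unfolding code_clique_def by blast

lemma inj_on_x: "C \<subseteq> M \<Longrightarrow> m < r \<Longrightarrow> inj_on (\<lambda>e. x e m) C"
  using disjoint_x by (meson inj_onI subsetD)

text \<open>The order by \<open>m\<close>-th vertices is the order by first vertices, either kept or
  reversed for all pairs at once. This permits working with \<open>x e m\<close> as the key.\<close>

lemma code_clique_leader:
  assumes "code_clique s m C" "C \<subseteq> M" "m < r" "e \<in> C" "f \<in> C" "x e 0 < x f 0"
  shows "x e m < x f m \<longleftrightarrow> upward s m" "x f m < x e m \<longleftrightarrow> \<not> upward s m"
proof -
  have "x e m < x f m \<longleftrightarrow> code_less s m m"
    using assms unfolding code_clique_def follows_def by blast
  then show *: "x e m < x f m \<longleftrightarrow> upward s m" by (simp add: code_less_def)
  have "x e m \<noteq> x f m" using assms disjoint_x by (metis less_irrefl subsetD)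
  then show "x f m < x e m \<longleftrightarrow> \<not> upward s m" using * by auto
qed

text \<open>The flag \<open>q\<close> compares the new order with the one at position
  \<open>m\<close>, whereas \<open>Up\<close> and \<open>Down\<close> refer to first vertices; the
  test \<open>upward s m = q\<close> translates between the two.\<close>

lemma code_clique_break:
  assumes cl: "code_clique s m C" and CM: "C \<subseteq> M" and m: "Suc m < r"
    and sep: "\<And>e f. \<lbrakk>e \<in> C; f \<in> C; e \<noteq> f\<rbrakk> \<Longrightarrow> x e m < x f (Suc m)"
    and dir: "\<And>e f. \<lbrakk>e \<in> C; f \<in> C; x e m < x f m\<rbrakk> \<Longrightarrow> x e (Suc m) < x f (Suc m) \<longleftrightarrow> q"
  shows "code_clique (s(m := (if upward s m = q then Up else Down))) (Suc m) C"
  unfolding code_clique_def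
proof (intro ballI impI)
  fix e f assume ef: "e \<in> C" "f \<in> C" "x e 0 < x f 0"
  then have ne: "e \<noteq> f" by auto
  have efM: "e \<in> M" "f \<in> M" using ef CM by auto
  have neS: "x e (Suc m) \<noteq> x f (Suc m)" using disjoint_x[OF efM ne m m] .
  note lead = code_clique_leader[OF cl CM Suc_lessD[OF m] ef]
  have "x e (Suc m) < x f (Suc m) \<longleftrightarrow> upward s m = q"
    using lead dir[of e f] dir[of f e] ef neS by (cases "upward s m") auto
  then show "follows (s(m := (if upward s m = q then Up else Down))) (Suc m) (x e) (x f)"
    using cl ef ne efM m sep[of e f] sep[of f e]
    by (intro follows_break mono_x) (auto simp: code_clique_def)
qed

lemma code_clique_join:
  assumes cl: "code_clique s m C" and CM: "C \<subseteq> M" and m: "Suc m < r"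
    and join: "\<And>e f i. \<lbrakk>e \<in> C; f \<in> C; x e m < x f m; i \<le> m; block s i = block s m\<rbrakk> \<Longrightarrow>
      x e (Suc m) < x f i"
  shows "code_clique (s(m := Join)) (Suc m) C"
  unfolding code_clique_def
proof (intro ballI impI)
  fix e f assume ef: "e \<in> C" "f \<in> C" "x e 0 < x f 0"
  then have ne: "e \<noteq> f" by auto
  have efM: "e \<in> M" "f \<in> M" using ef CM by auto
  note lead = code_clique_leader[OF cl CM Suc_lessD[OF m] ef]
  show "follows (s(m := Join)) (Suc m) (x e) (x f)"
  proof (rule follows_join)
    show "follows s m (x e) (x f)" using cl ef unfolding code_clique_def by blast
    show "if upward s m then x e (Suc m) < x f i else x f (Suc m) < x e i"
      if "i \<le> m" "block s i = block s m" for i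
      using that join ef lead by simp
  qed (use efM m mono_x disjoint_x ne in auto)
qed

text \<open>Inserting an intermediate edge \<open>f\<close> between \<open>e\<close> and \<open>g\<close> separates the whole block:
  \<open>e\<^bsub>m+1\<^esub> < f\<^bsub>m\<^esub> < g\<^bsub>i\<^esub>\<close> for every position \<open>i \<le> m\<close> of the block. In a clean family \<open>e\<^bsub>m+1\<^esub> < g\<^bsub>m\<^esub>\<close> already
  forces the full block.\<close>
lemma joined_chain:
  assumes d: "d = 2 \<or> d = 1 \<and>
      (\<forall>e\<in>M. \<forall>f\<in>M. x e 0 < x f 0 \<longrightarrow> (\<exists>s. follows s (r - 1) (x e) (x f)))"
    and cl: "code_clique s m C" and CM: "C \<subseteq> M" and m: "Suc m < r"
    and chain: "\<And>e f. \<lbrakk>e \<in> C; f \<in> C; x e m < x f m\<rbrakk> \<Longrightarrow> x e (Suc m) < x f m"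
  obtains D where "D \<subseteq> C" "code_clique (s(m := Join)) (Suc m) D"
    "real (card C) / (if block_length s m = 1 then 1 else d) \<le> real (card D)"
proof -
  have fin: "finite C" using CM finite_M finite_subset by blast
  consider "block_length s m = 1" | "block_length s m \<noteq> 1" "d = 2" | "block_length s m \<noteq> 1" "d = 1"
    "\<forall>e\<in>M. \<forall>f\<in>M. x e 0 < x f 0 \<longrightarrow> (\<exists>s. follows s (r - 1) (x e) (x f))"
    using d by blast
  then show ?thesis
  proof cases
    case 1
    \<comment> \<open>The current block is the single position \<open>m\<close>, so the chain
      condition is already the full separation.\<close>
    have "code_clique (s(m := Join)) (Suc m) C"
    proof (rule code_clique_join[OF cl CM m])
      fix e f i assume *: "e \<in> C" "f \<in> C" "x e m < x f m" "i \<le> m" "block s i = block s m"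
      then have "i = m" using 1 block_eq_iff_block_length[of i m s] by simp
      then show "x e (Suc m) < x f i" using chain * by simp
    qed
    then show ?thesis using that[of C] 1 by simp
  next
    case 2
    obtain D where D: "D \<subseteq> C" "real (card C) / 2 \<le> real (card D)"
      and between: "\<And>e g. \<lbrakk>e \<in> D; g \<in> D; x e m < x g m\<rbrakk> \<Longrightarrow> \<exists>f\<in>C. x e m < x f m \<and> x f m < x g m"
      using every_other[OF fin inj_on_x[OF CM]] m by (metis Suc_lessD)
    have "code_clique (s(m := Join)) (Suc m) D"
    proof (rule code_clique_join[OF code_clique_subset[OF cl D(1)] _ m])
      show "D \<subseteq> M" using D(1) CM by blast
      fix e g i assume eg: "e \<in> D" "g \<in> D" "x e m < x g m" and i: "i \<le> m" "block s i = block s m"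
      obtain f where f: "f \<in> C" "x e m < x f m" "x f m < x g m" using between eg by blast
      have g: "g \<in> C" "e \<in> C" using eg D by auto
      have up: "upward s i = upward s m" using upward_eq_if_block_eq[OF i(2)] .
      have cle: "code_less s m i = upward s m" "code_less s i m = upward s m"
        using i(2) up by (auto simp: code_less_def)
      have ne: "f \<noteq> g" using f by auto
      \<comment> \<open>As \<open>f\<close> precedes \<open>g\<close> at position \<open>m\<close>,
        it leads the whole block, whichever of the two has the smaller first vertex.\<close>
      have "x f m < x g i"
      proof (cases "x f 0 < x g 0")
        case True
        then have "upward s m" using code_clique_leader(1)[OF cl CM _ f(1) g(1)] f m by simp
        moreover have "follows s m (x f) (x g)" using True cl f g unfolding code_clique_def by blast
        ultimately show ?thesis using cle i unfolding follows_def by auto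
      next
        case False
        then have lt: "x g 0 < x f 0" using disjoint_x[of f g 0 0] f(1) g(1) CM ne m by force
        then have "\<not> upward s m" using code_clique_leader(2)[OF cl CM _ g(1) f(1)] f m by simp
        moreover have "follows s m (x g) (x f)" using lt cl f g unfolding code_clique_def by blast
        ultimately have "\<not> x g i < x f m" using cle i unfolding follows_def by auto
        then show ?thesis using disjoint_x[of g f i m] f(1) g(1) CM ne m i by force
      qed
      moreover have "x e (Suc m) < x f m" using chain f g by blast
      ultimately show "x e (Suc m) < x g i" by simp
    qed
    then show ?thesis using that[of D] D 2 by simp
  next
    case 3
    have "code_clique (s(m := Join)) (Suc m) C"
      unfolding code_clique_def
    proof (intro ballI impI)
      fix e f assume ef: "e \<in> C" "f \<in> C" "x e 0 < x f 0"
      then have ne: "e \<noteq> f" by auto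
      have efM: "e \<in> M" "f \<in> M" using ef CM by auto
      obtain t where t: "follows t (r - 1) (x e) (x f)" using 3 ef efM by blast
      have tS: "follows t (Suc m) (x e) (x f)" using t m by (intro follows_mono[OF t]) simp
      have tm: "t k = s k" if "k < m" for k
        using follows_unique[OF follows_mono[OF tS] _ that] cl ef unfolding code_clique_def by simp
      have neq: "x e m \<noteq> x f m" using disjoint_x[OF efM ne, of m m] m by simp
      \<comment> \<open>The full code \<open>t\<close> of the pair extends \<open>s\<close>. A new
        vertex of one edge lying below the \<open>m\<close>-th vertex of the other is impossible
        when a new block starts.\<close>
      have "t m = Join"
      proof (cases "x e m < x f m")
        case True
        then have "x e (Suc m) < x f m" using chain ef by blast
        then show ?thesis using tS step_from_code_less[of t m] unfolding follows_def by auto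
      next
        case False
        then have "x f (Suc m) < x e m" using chain ef neq by force
        then have "\<not> x e m < x f (Suc m)" by simp
        then show ?thesis using tS step_from_code_less[of t m] unfolding follows_def by auto
      qed
      then have "follows t (Suc m) (x e) (x f) = follows (s(m := Join)) (Suc m) (x e) (x f)"
        using tm by (intro follows_cong) (auto simp: less_Suc_eq)
      then show "follows (s(m := Join)) (Suc m) (x e) (x f)" using tS by simp
    qed
    then show ?thesis using that[of C] 3 by simp
  qed
qed

text \<open>The factor \<open>d\<close> is paid only for the third and later positions of a block,
  hence the truncated exponent; a new block resets it to zero. The value \<open>d = 2\<close>
  accounts for halving, \<open>d = 1\<close> for clean families.\<close>

lemma large_code_clique:
  fixes a :: "(nat \<Rightarrow> step) \<Rightarrow> real"
  assumes d: "d = 2 \<or> d = 1 \<and>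
      (\<forall>e\<in>M. \<forall>f\<in>M. x e 0 < x f 0 \<longrightarrow> (\<exists>s. follows s (r - 1) (x e) (x f)))"
    and "m < r" "\<And>s. s \<in> codes m \<Longrightarrow> 0 < a s" "prod a (codes m) < card M"
  shows "\<exists>s\<in>codes m. \<exists>C\<subseteq>M. code_clique s m C \<and> a s / d ^ (block_length s m - 2) < card C"
  using assms(2-)
proof (induction m arbitrary: a)
  case 0
  \<comment> \<open>Without steps the only requirement concerns the first vertices, and it is the
    ordering of the pair itself.\<close>
  have "code_clique s 0 M" for s
    by (simp add: code_clique_def follows_def code_less_def)
  then show ?case using 0 by (intro bexI[of _ "\<lambda>_. undefined"] exI[of _ M]) (auto simp: codes_def)
next
  case (Suc m)
  \<comment> \<open>The three possible continuations of a code share its weight as a product, so the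
    total product is unchanged.\<close>
  define b where "b s = a (s(m := Join)) * a (s(m := Up)) * a (s(m := Down))" for s
  have pos: "0 < a (s(m := t))" if "s \<in> codes m" for s t
    using Suc.prems(2) fun_upd_in_codes[OF that] by blast
  have "\<exists>s\<in>codes m. \<exists>C\<subseteq>M. code_clique s m C \<and> b s / d ^ (block_length s m - 2) < card C"
  proof (rule Suc.IH)
    show "m < r" using Suc.prems by simp
    show "0 < b s" if "s \<in> codes m" for s
      unfolding b_def by (intro mult_pos_pos pos that)
    show "prod b (codes m) < card M"
      using Suc.prems(3) unfolding prod_codes_Suc b_def .
  qed
  then obtain s C where s: "s \<in> codes m" and CM: "C \<subseteq> M" and cl: "code_clique s m C"
    and card: "b s / d ^ (block_length s m - 2) < card C" by blast
  \<comment> \<open>\<open>same\<close> and \<open>opp\<close> are the new-block steps that keep or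
    reverse the order by \<open>m\<close>-th vertices.\<close>
  define same where "same = (if upward s m then Up else Down)"
  define opp where "opp = (if upward s m then Down else Up)"
  \<comment> \<open>The loss accumulated so far is charged entirely to \<open>Join\<close>, since
    the other two steps start a block with exponent zero.\<close>
  define \<gamma> where "\<gamma> = a (s(m := Join)) / d ^ (block_length s m - 2)"
  have dpos: "0 < d" using d by auto
  have \<gamma>0: "0 \<le> \<gamma>" using pos[OF s] dpos unfolding \<gamma>_def by (simp add: less_imp_le)
  have bl: "block_length (s(m := t)) (Suc m) = 1" if "t \<noteq> Join" for t
    using that by simp
  have blJ: "block_length (s(m := Join)) (Suc m) = Suc (block_length s m)"
    using block_length_cong[of m "s(m := Join)" s] by simp
  have prod: "a (s(m := opp)) * (\<gamma> * a (s(m := same))) < card C"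
    using card unfolding \<gamma>_def b_def opp_def same_def by (simp add: mult.commute mult.left_commute)
  have fin: "finite D" if "D \<subseteq> M" for D using that finite_M finite_subset by blast
  have lt: "x e m < x e (Suc m)" if "e \<in> M" for e using mono_x[OF that, of m] Suc.prems(1) by simp
  have result: ?case if "D \<subseteq> M" "code_clique (s(m := t)) (Suc m) D"
    "a (s(m := t)) / d ^ (block_length (s(m := t)) (Suc m) - 2) < card D" for t D
    using that fun_upd_in_codes[OF s] by blast
  show ?case
  \<comment> \<open>First split: a chain reverses the order and gives \<open>opp\<close>; an
    antichain preserves it and is split again.\<close>
  proof (rule chain_or_antichain[where C = C and key = "\<lambda>e. x e m"
        and R = "\<lambda>e f. x e m < x f m \<and> x f (Suc m) < x e (Suc m)", OF _ _ _ _ _ prod])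
    show "finite C" "inj_on (\<lambda>e. x e m) C" using fin inj_on_x CM Suc.prems(1) by auto
    show "0 \<le> a (s(m := opp))" using pos[OF s, of opp] by simp
  next
    fix D assume D: "D \<subseteq> C" "a (s(m := opp)) < card D"
      and ch: "\<forall>e\<in>D. \<forall>f\<in>D. x e m < x f m \<longrightarrow> x e m < x f m \<and> x f (Suc m) < x e (Suc m)"
    have DM: "D \<subseteq> M" using D CM by blast
    have "code_clique (s(m := (if upward s m = False then Up else Down))) (Suc m) D"
    proof (rule code_clique_break[OF code_clique_subset[OF cl D(1)] DM Suc.prems(1)])
      fix e f assume ef: "e \<in> D" "f \<in> D" "e \<noteq> f"
      then have "e \<in> M" "f \<in> M" using DM by auto
      \<comment> \<open>Reversal separates by itself: if \<open>x e m < x f m\<close>, then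
        \<open>x e m < x f m < x f (Suc m) < x e (Suc m)\<close>.\<close>
      then show "x e m < x f (Suc m)"
        using ch ef lt[of e] lt[of f] by (metis less_trans linorder_less_linear)
    next
      fix e f assume "e \<in> D" "f \<in> D" "x e m < x f m"
      then show "x e (Suc m) < x f (Suc m) \<longleftrightarrow> False" using ch by (auto dest: less_asym)
    qed
    moreover have "(if upward s m = False then Up else Down) = opp" unfolding opp_def by simp
    ultimately show ?case using result[OF DM] bl[of opp] D(2) by (simp add: opp_def)
  next
    fix D assume D: "D \<subseteq> C" "\<gamma> * a (s(m := same)) < card D"
      and anti: "\<forall>e\<in>D. \<forall>f\<in>D. \<not> (x e m < x f m \<and> x f (Suc m) < x e (Suc m))"
    have DM: "D \<subseteq> M" using D CM by blast
    have clD: "code_clique s m D" using code_clique_subset[OF cl D(1)] .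
    have dir: "x e (Suc m) < x f (Suc m)" if "e \<in> D" "f \<in> D" "x e m < x f m" for e f
    proof -
      have "e \<in> M" "f \<in> M" "e \<noteq> f" using that DM by auto
      then have "x e (Suc m) \<noteq> x f (Suc m)" using disjoint_x Suc.prems(1) by blast
      then show ?thesis using anti that by force
    qed
    show ?case
    \<comment> \<open>Second split: a chain continues the block, an antichain starts a new one in
      the same direction.\<close>
    proof (rule chain_or_antichain[where C = D and key = "\<lambda>e. x e m"
          and R = "\<lambda>e f. x e (Suc m) < x f m", OF _ _ _ _ \<gamma>0 D(2)])
      show "finite D" "inj_on (\<lambda>e. x e m) D" using fin inj_on_x DM Suc.prems(1) by auto
      show "x e m < x f m" if "e \<in> D" "f \<in> D" "x e (Suc m) < x f m" for e f
        using that lt[of e] DM by (meson less_trans subsetD)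
      show "x e (Suc m) < x g m"
        if "e \<in> D" "f \<in> D" "g \<in> D" "x e (Suc m) < x f m" "x f (Suc m) < x g m" for e f g
        using that lt[of f] DM by (meson less_trans subsetD)
    next
      fix E assume E: "E \<subseteq> D" "\<gamma> < card E"
        and ch: "\<forall>e\<in>E. \<forall>f\<in>E. x e m < x f m \<longrightarrow> x e (Suc m) < x f m"
      have EM: "E \<subseteq> M" using E DM by blast
      obtain F where F: "F \<subseteq> E" "code_clique (s(m := Join)) (Suc m) F"
        "real (card E) / (if block_length s m = 1 then 1 else d) \<le> real (card F)"
        by (rule joined_chain[OF d code_clique_subset[OF clD E(1)] EM Suc.prems(1)]) (use ch in blast)+
      \<comment> \<open>Truncated subtraction makes lengths one and two both give exponent zero;
        from length two on, each join adds one.\<close>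
      have exp: "d ^ (block_length (s(m := Join)) (Suc m) - 2) =
          d ^ (block_length s m - 2) * (if block_length s m = 1 then 1 else d)"
        unfolding blJ using block_length_pos[of s m]
        by (cases "block_length s m" rule: nat.exhaust; cases "block_length s m - 1")
          (auto simp: mult.commute)
      have "a (s(m := Join)) / d ^ (block_length (s(m := Join)) (Suc m) - 2) =
          \<gamma> / (if block_length s m = 1 then 1 else d)"
        unfolding exp \<gamma>_def by simp
      also have "\<dots> < real (card E) / (if block_length s m = 1 then 1 else d)"
        using E(2) dpos by (intro divide_strict_right_mono) auto
      also note F(3)
      finally show ?case using result[of F Join] F EM by auto
    next
      fix E assume E: "E \<subseteq> D" "a (s(m := same)) < card E"
        and no: "\<forall>e\<in>E. \<forall>f\<in>E. \<not> x e (Suc m) < x f m"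
      have EM: "E \<subseteq> M" using E DM by blast
      have "code_clique (s(m := (if upward s m = True then Up else Down))) (Suc m) E"
      proof (rule code_clique_break[OF code_clique_subset[OF clD E(1)] EM Suc.prems(1)])
        fix e f assume ef: "e \<in> E" "f \<in> E" "e \<noteq> f"
        then have "e \<in> M" "f \<in> M" using EM by auto
        then have "x f (Suc m) \<noteq> x e m" using disjoint_x ef(3) Suc.prems(1) by auto
        then show "x e m < x f (Suc m)" using no ef by force
      next
        fix e f assume "e \<in> E" "f \<in> E" "x e m < x f m"
        then show "x e (Suc m) < x f (Suc m) \<longleftrightarrow> True" using dir E by auto
      qed
      moreover have "(if upward s m = True then Up else Down) = same" unfolding same_def by simp
      ultimately show ?case using result[OF EM] bl[of same] E(2) by (simp add: same_def)
    qed
  qed auto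
qed

end

section \<open>Realizing codes by patterns\<close>

definition elt :: "'a::linorder set \<Rightarrow> nat \<Rightarrow> 'a" where
  "elt e i = sorted_list_of_set e ! i"

lemma elt_less:
  assumes "i < j" "j < card e" shows "elt e i < elt e j"
  unfolding elt_def using assms
  by (intro sorted_wrt_nth_less[of "(<)"]) auto

lemma elt_image: "finite e \<Longrightarrow> elt e ` {..<card e} = e"
  unfolding elt_def
  by (metis length_sorted_list_of_set lessThan_atLeast0 list.set_map map_nth set_sorted_list_of_set set_upt)

lemma elt_in: "finite e \<Longrightarrow> i < card e \<Longrightarrow> elt e i \<in> e"
  using elt_image by blast

lemma elt_inj_on: "inj_on (elt e) {..<card e}"
  by (rule linorder_inj_onI) (auto dest: elt_less)

lemma elt_eqI:
  assumes "strict_mono_on {..<n} u" "i < n"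
  shows "elt (u ` {..<n}) i = u i"
proof -
  have "sorted_wrt (<) (map u [0..<n])"
    using assms(1) by (auto simp: sorted_wrt_iff_nth_less strict_mono_on_def)
  then have "sorted_list_of_set (set (map u [0..<n])) = map u [0..<n]"
    by (intro sorted_list_of_set.idem_if_sorted_distinct) (simp_all add: strict_sorted_iff)
  then show ?thesis using assms(2) by (simp add: elt_def lessThan_atLeast0)
qed

lemma elt_strict_mono_image:
  assumes "finite e" "strict_mono_on e \<phi>" "i < card e"
  shows "elt (\<phi> ` e) i = \<phi> (elt e i)"
proof -
  have "strict_mono_on {..<card e} (\<phi> \<circ> elt e)"
    using assms elt_less elt_in unfolding strict_mono_on_def by (metis comp_apply lessThan_iff)
  from elt_eqI[OF this assms(3)] show ?thesis
    using elt_image[OF assms(1)] by (metis comp_apply image_comp)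
qed

text \<open>Send the \<open>i\<close>-th vertex of each edge to the \<open>i\<close>-th vertex of
  its counterpart. The comparisons in \<open>type\<close> run one way only; disjointness excludes
  ties and so yields the other way.\<close>

lemma same_type_isomorphism:
  fixes e f :: "'a::linorder set" and e' f' :: "'b::linorder set"
  assumes fin: "finite e" "finite f" "finite e'" "finite f'"
    and card: "card e = r" "card f = r" "card e' = r" "card f' = r"
    and disj: "e \<inter> f = {}" "e' \<inter> f' = {}"
    and type: "\<And>i j. \<lbrakk>i < r; j < r\<rbrakk> \<Longrightarrow> elt e i < elt f j \<longleftrightarrow> elt e' i < elt f' j"
  obtains \<phi> where "strict_mono_on (e \<union> f) \<phi>" "\<phi> ` e = e'" "\<phi> ` f = f'"
proof -
  define \<phi> where "\<phi> v = (if v \<in> e then elt e' (the_inv_into {..<r} (elt e) v)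
    else elt f' (the_inv_into {..<r} (elt f) v))" for v
  have e: "\<phi> (elt e i) = elt e' i" if "i < r" for i
    using that elt_in[OF fin(1), of i] the_inv_into_f_f[OF elt_inj_on, of i e] card
    by (simp add: \<phi>_def)
  have f: "\<phi> (elt f i) = elt f' i" if "i < r" for i
    using that elt_in[OF fin(2), of i] the_inv_into_f_f[OF elt_inj_on, of i f] card disj(1)
    by (auto simp: \<phi>_def)
  have img: "elt e ` {..<r} = e" "elt f ` {..<r} = f" "elt e' ` {..<r} = e'" "elt f' ` {..<r} = f'"
    using fin[THEN elt_image] unfolding card by simp_all
  have "\<phi> ` elt e ` {..<r} = elt e' ` {..<r}" "\<phi> ` elt f ` {..<r} = elt f' ` {..<r}"
    unfolding image_image using e f by (intro image_cong; simp)+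
  then have image: "\<phi> ` e = e'" "\<phi> ` f = f'" unfolding img by simp_all
  have index: "\<exists>i<r. v = elt e i" if "v \<in> e" for v using that img(1) by blast
  have index': "\<exists>i<r. v = elt f i" if "v \<in> f" for v using that img(2) by blast
  have elt_mono: "i < j" if "elt g i < elt g j" "i < card g" for g :: "'a set" and i j
    using that elt_less[of j i g] by (cases i j rule: linorder_cases) auto
  have "strict_mono_on (e \<union> f) \<phi>"
  proof (rule strict_mono_onI)
    fix v w assume vw: "v \<in> e \<union> f" "w \<in> e \<union> f" "v < w"
    consider "v \<in> e" "w \<in> e" | "v \<in> e" "w \<in> f" | "v \<in> f" "w \<in> e" | "v \<in> f" "w \<in> f"
      using vw(1,2) by blast
    then show "\<phi> v < \<phi> w"
    proof cases
      case 1
      then obtain i j where ij: "i < r" "j < r" "v = elt e i" "w = elt e j"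
        using index by meson
      then have "i < j" using vw(3) elt_mono[of e i j] card by simp
      then show ?thesis unfolding ij(3,4) e[OF ij(1)] e[OF ij(2)]
        using elt_less[of i j e'] ij(2) card by simp
    next
      case 2
      then obtain i j where ij: "i < r" "j < r" "v = elt e i" "w = elt f j"
        using index index' by meson
      then show ?thesis unfolding ij(3,4) e[OF ij(1)] f[OF ij(2)]
        using vw(3)[unfolded ij(3,4)] type[OF ij(1,2)] by simp
    next
      case 3
      then obtain i j where ij: "i < r" "j < r" "v = elt f i" "w = elt e j"
        using index index' by meson
      have "elt e' j \<noteq> elt f' i"
        using ij elt_in[OF fin(3), of j] elt_in[OF fin(4), of i] card disj(2) by auto
      moreover have "\<not> elt e' j < elt f' i"
        using vw(3) type[OF ij(2,1)] ij(3,4) by auto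
      ultimately show ?thesis unfolding ij(3,4) f[OF ij(1)] e[OF ij(2)] by simp
    next
      case 4
      then obtain i j where ij: "i < r" "j < r" "v = elt f i" "w = elt f j"
        using index' by meson
      then have "i < j" using vw(3) elt_mono[of f i j] card by simp
      then show ?thesis unfolding ij(3,4) f[OF ij(1)] f[OF ij(2)]
        using elt_less[of i j f'] ij(2) card by simp
    qed
  qed
  then show ?thesis using that image by blast
qed

lemma rank_isomorphism:
  assumes "finite (W :: 'a::linorder set)"
  obtains \<phi> where "strict_mono_on W \<phi>" "\<phi> ` W = {1..card W}"
proof -
  define \<phi> where "\<phi> v = card {u \<in> W. u \<le> v}" for v
  have mono: "strict_mono_on W \<phi>"
  proof (rule strict_mono_onI)
    fix v w assume vw: "v \<in> W" "w \<in> W" "v < w"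
    then have "w \<in> {u \<in> W. u \<le> w} - {u \<in> W. u \<le> v}" by auto
    moreover have "{u \<in> W. u \<le> v} \<subseteq> {u \<in> W. u \<le> w}" using vw by auto
    ultimately show "\<phi> v < \<phi> w"
      unfolding \<phi>_def using assms by (intro psubset_card_mono) auto
  qed
  have "\<phi> ` W \<subseteq> {1..card W}"
  proof
    fix n assume "n \<in> \<phi> ` W"
    then obtain v where v: "v \<in> W" "n = \<phi> v" by blast
    have "card {v} \<le> \<phi> v" unfolding \<phi>_def using assms v by (intro card_mono) auto
    moreover have "\<phi> v \<le> card W" unfolding \<phi>_def using assms by (intro card_mono) auto
    ultimately show "n \<in> {1..card W}" using v by simp
  qed
  moreover have "card (\<phi> ` W) = card W"
    using card_image[OF strict_mono_on_imp_inj_on[OF mono]] .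
  ultimately have "\<phi> ` W = {1..card W}" by (simp add: card_subset_eq)
  then show ?thesis using that mono by blast
qed

section \<open>Patterns realizing a code\<close>

definition realizes :: "nat \<Rightarrow> (nat \<Rightarrow> step) \<Rightarrow> nat set set \<Rightarrow> bool" where
  "realizes r s Q \<longleftrightarrow> pattern r Q \<and> (\<exists>A B. Q = {A, B} \<and> follows s (r - 1) (elt A) (elt B))"

lemma realizesE:
  assumes "realizes r s Q"
  obtains A B where "Q = {A, B}" "A \<inter> B = {}" "finite A" "finite B" "card A = r" "card B = r"
    "A \<union> B = {1..2 * r}" "follows s (r - 1) (elt A) (elt B)"
proof -
  obtain A B where AB: "Q = {A, B}" "follows s (r - 1) (elt A) (elt B)" and pat: "pattern r Q"
    using assms unfolding realizes_def by blast
  have ne: "A \<noteq> B" using AB pat unfolding pattern_def by auto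
  have part: "partition_on {1..2 * r} Q" and c: "\<forall>e\<in>Q. card e = r"
    using pat unfolding pattern_def ordered_matching_def by auto
  have un: "A \<union> B = {1..2 * r}" using partition_onD1[OF part] AB(1) by simp
  have "A \<inter> B = {}" using partition_onD2[OF part] AB(1) ne by (auto simp: disjoint_def)
  moreover have "finite A" "finite B" using un by (metis finite_Un finite_atLeastAtMost)+
  ultimately show ?thesis using that[OF AB(1)] AB un c by simp
qed

lemma realizes_forms_pattern:
  fixes e f :: "'a::linorder set"
  assumes "realizes r s Q" "0 < r"
    and "finite e" "finite f" "card e = r" "card f = r" "e \<inter> f = {}"
    and "follows s (r - 1) (elt e) (elt f)"
  shows "forms_pattern e f Q"
proof -
  obtain A B where Q: "Q = {A, B}" "A \<inter> B = {}" "finite A" "finite B" "card A = r" "card B = r"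
    "follows s (r - 1) (elt A) (elt B)"
    using realizesE[OF assms(1)] by metis
  have "elt e i < elt f j \<longleftrightarrow> elt A i < elt B j" if "i < r" "j < r" for i j
    using that assms(8) Q(7) unfolding follows_def by simp
  then obtain \<phi> where "strict_mono_on (e \<union> f) \<phi>" "\<phi> ` e = A" "\<phi> ` f = B"
    using same_type_isomorphism[of e f A B r] assms Q by metis
  then show ?thesis unfolding forms_pattern_def order_isomorphic_def Q(1) by auto
qed

text \<open>An isomorphism onto the pattern transports all comparisons. It might swap the two edges,
  but then the order of the first vertices would be violated, as a code always puts the first edge's
  first vertex lower.\<close>

lemma forms_pattern_follows:
  fixes e f :: "'a::linorder set"
  assumes "realizes r s Q" "0 < r" "forms_pattern e f Q"
    and "finite e" "finite f" "card e = r" "card f = r"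
    and "elt e 0 < elt f 0"
  shows "follows s (r - 1) (elt e) (elt f)"
proof -
  obtain A B where Q: "Q = {A, B}" "follows s (r - 1) (elt A) (elt B)"
    using realizesE[OF assms(1)] by metis
  obtain \<phi> where \<phi>: "strict_mono_on (e \<union> f) \<phi>" "{\<phi> ` e, \<phi> ` f} = {A, B}"
    using assms(3) unfolding forms_pattern_def order_isomorphic_def Q(1) by auto
  have mono: "strict_mono_on e \<phi>" "strict_mono_on f \<phi>"
    using \<phi>(1) by (auto simp: strict_mono_on_def)
  have elt: "elt (\<phi> ` e) i = \<phi> (elt e i)" "elt (\<phi> ` f) i = \<phi> (elt f i)" if "i < r" for i
    using that assms elt_strict_mono_image[OF assms(4) mono(1)]
      elt_strict_mono_image[OF assms(5) mono(2)] by auto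
  have less: "\<phi> v < \<phi> w \<longleftrightarrow> v < w" if "v \<in> e \<union> f" "w \<in> e \<union> f" for v w
    using strict_mono_on_less[OF \<phi>(1) that] .
  have in_ef: "elt e i \<in> e \<union> f" "elt f i \<in> e \<union> f" if "i < r" for i
    using that elt_in[of e i] elt_in[of f i] assms by auto
  consider "\<phi> ` e = A" "\<phi> ` f = B" | "\<phi> ` e = B" "\<phi> ` f = A"
    using \<phi>(2) by (auto simp: doubleton_eq_iff)
  then show ?thesis
  proof cases
    case 1
    then show ?thesis
      using Q(2) elt less in_ef assms(2) unfolding follows_def
      by (metis One_nat_def Suc_pred less_Suc_eq_le)
  next
    case 2
    then have "elt A 0 = \<phi> (elt f 0)" "elt B 0 = \<phi> (elt e 0)" using elt assms(2) by auto
    moreover have "elt A 0 < elt B 0"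
      using Q(2) unfolding follows_def by (simp add: code_less_def)
    ultimately have "elt f 0 < elt e 0" using less in_ef assms(2) by simp
    then show ?thesis using assms(8) by simp
  qed
qed

lemma clique_if_follows:
  fixes C :: "'a::linorder set set"
  assumes "realizes r s Q" "0 < r" "finite C"
    and C: "\<And>e. e \<in> C \<Longrightarrow> finite e" "\<And>e. e \<in> C \<Longrightarrow> card e = r"
    and disj: "\<And>e f. \<lbrakk>e \<in> C; f \<in> C; e \<noteq> f\<rbrakk> \<Longrightarrow> e \<inter> f = {}"
    and fol: "\<And>e f. \<lbrakk>e \<in> C; f \<in> C; elt e 0 < elt f 0\<rbrakk> \<Longrightarrow> follows s (r - 1) (elt e) (elt f)"
  shows "clique r Q C"
  unfolding clique_def
proof (intro conjI ballI impI)
  have "{} \<notin> C" using C(2) assms(2) by fastforce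
  then show "ordered_matching r (\<Union>C) C"
    using assms(3) C disj unfolding ordered_matching_def partition_on_def disjoint_def by auto
next
  fix e f assume ef: "e \<in> C" "f \<in> C" "e \<noteq> f"
  have "elt e 0 \<in> e" "elt f 0 \<in> f" using ef C assms(2) by (auto intro: elt_in)
  then consider "elt e 0 < elt f 0" | "elt f 0 < elt e 0"
    using disj[OF ef] by (metis disjoint_iff linorder_less_linear)
  then show "forms_pattern e f Q"
  proof cases
    case 1
    show ?thesis
      by (intro realizes_forms_pattern[OF assms(1,2)] C disj fol ef 1)
  next
    case 2
    have "forms_pattern f e Q"
      by (intro realizes_forms_pattern[OF assms(1,2)] C disj fol ef(1,2) ef(3)[symmetric] 2)
    then show ?thesis unfolding forms_pattern_def by (simp add: insert_commute)
  qed
qed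

section \<open>Model cliques of arbitrary size\<close>

text \<open>The triples (block, edge, position) are ordered lexicographically, with the order of the \<open>k\<close>
  edges reversed in the downward blocks.\<close>
definition model_point :: "(nat \<Rightarrow> step) \<Rightarrow> nat \<Rightarrow> nat \<Rightarrow> nat \<Rightarrow> nat \<Rightarrow> nat" where
  "model_point s r k m i = (block s i * k + (if upward s i then m else k - 1 - m)) * r + i"

definition model_edge :: "(nat \<Rightarrow> step) \<Rightarrow> nat \<Rightarrow> nat \<Rightarrow> nat \<Rightarrow> nat set" where
  "model_edge s r k m = model_point s r k m ` {..<r}"

text \<open>Lexicographic comparison in mixed radix: it is used with radix \<open>r\<close> for
  positions and radix \<open>k\<close> for edges within a block.\<close>

lemma mult_add_less_mult_add:
  fixes p q i j r :: nat
  assumes "p < q" "i < r" shows "p * r + i < q * r + j"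
proof -
  have "p * r + i < Suc p * r" using assms(2) by simp
  also have "\<dots> \<le> q * r" using assms(1) by (intro mult_le_mono1) simp
  finally show ?thesis by simp
qed

lemma model_point_less:
  assumes "m < k" "i < r" "i < j"
  shows "model_point s r k m i < model_point s r k m j"
proof (cases "block s i = block s j")
  case True
  then show ?thesis using assms(3) upward_eq_if_block_eq[OF True] by (simp add: model_point_def)
next
  case False
  then have "block s i < block s j" using block_mono[of i j s] assms(3) by simp
  then show ?thesis
    unfolding model_point_def using assms by - (rule mult_add_less_mult_add, rule mult_add_less_mult_add, auto)
qed

lemma model_point_code_less:
  assumes "m < m'" "m' < k" "i < r" "j < r"
  shows "model_point s r k m i < model_point s r k m' j \<longleftrightarrow> code_less s i j"
proof -
  consider "block s i < block s j" | "block s j < block s i" | "block s i = block s j" "upward s i"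
    | "block s i = block s j" "\<not> upward s i"
    by linarith
  then show ?thesis
  proof cases
    case 1
    then have "model_point s r k m i < model_point s r k m' j"
      unfolding model_point_def using assms by - (rule mult_add_less_mult_add, rule mult_add_less_mult_add, auto)
    then show ?thesis using 1 by (simp add: code_less_def)
  next
    case 2
    then have "model_point s r k m' j < model_point s r k m i"
      unfolding model_point_def using assms by - (rule mult_add_less_mult_add, rule mult_add_less_mult_add, auto)
    then show ?thesis using 2 by (simp add: code_less_def)
  next
    case 3
    then have "model_point s r k m i < model_point s r k m' j"
      unfolding model_point_def using assms upward_eq_if_block_eq[OF 3(1)]
      by - (rule mult_add_less_mult_add, auto)
    then show ?thesis using 3 by (simp add: code_less_def)
  next
    case 4
    then have "model_point s r k m' j < model_point s r k m i"
      unfolding model_point_def using assms upward_eq_if_block_eq[OF 4(1)]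
      by - (rule mult_add_less_mult_add, auto)
    then show ?thesis using 4 by (simp add: code_less_def)
  qed
qed

lemma strict_mono_on_model_point: "m < k \<Longrightarrow> strict_mono_on {..<r} (model_point s r k m)"
  by (auto simp: strict_mono_on_def intro: model_point_less)

lemma elt_model_edge: "m < k \<Longrightarrow> i < r \<Longrightarrow> elt (model_edge s r k m) i = model_point s r k m i"
  unfolding model_edge_def by (intro elt_eqI strict_mono_on_model_point)

lemma finite_model_edge: "finite (model_edge s r k m)"
  by (simp add: model_edge_def)

lemma card_model_edge: "m < k \<Longrightarrow> card (model_edge s r k m) = r"
  using card_image[OF strict_mono_on_imp_inj_on[OF strict_mono_on_model_point]]
  by (simp add: model_edge_def)

lemma model_edge_disjoint:
  assumes "m < k" "m' < k" "m \<noteq> m'"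
  shows "model_edge s r k m \<inter> model_edge s r k m' = {}"
proof -
  have False if ij: "i < r" "j < r" "model_point s r k m i = model_point s r k m' j" for i j
  proof -
    \<comment> \<open>The position is the residue modulo \<open>r\<close>; the block is then the
      same on both sides, which leaves only the edge index to compare.\<close>
    have "i = j"
      using arg_cong[OF ij(3), of "\<lambda>v. v mod r"] ij(1,2) by (simp add: model_point_def)
    then show False
      using ij assms by (auto simp: model_point_def split: if_splits)
  qed
  then show ?thesis unfolding model_edge_def by auto
qed

lemma follows_model_edge:
  assumes "m < m'" "m' < k" "0 < r"
  shows "follows s (r - 1) (elt (model_edge s r k m)) (elt (model_edge s r k m'))"
  unfolding follows_def using assms by (auto simp: elt_model_edge model_point_code_less)

text \<open>Take two model edges and relabel their union by ranks to reach the vertex set required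
  of a pattern.\<close>

lemma realizes_exists:
  assumes "0 < r" obtains Q where "realizes r s Q"
proof -
  define e f where "e = model_edge s r 2 0" and "f = model_edge s r 2 1"
  have fin: "finite e" "finite f" and c: "card e = r" "card f = r" and disj: "e \<inter> f = {}"
    unfolding e_def f_def by (simp_all add: finite_model_edge card_model_edge model_edge_disjoint)
  have fol: "follows s (r - 1) (elt e) (elt f)"
    unfolding e_def f_def using assms by (intro follows_model_edge) auto
  have card_un: "card (e \<union> f) = 2 * r" using c fin disj by (simp add: card_Un_disjoint)
  obtain \<phi> where \<phi>: "strict_mono_on (e \<union> f) \<phi>" "\<phi> ` (e \<union> f) = {1..2 * r}"
    using rank_isomorphism[of "e \<union> f"] fin card_un by (metis finite_UnI)
  have inj: "inj_on \<phi> (e \<union> f)" using strict_mono_on_imp_inj_on[OF \<phi>(1)] .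
  have cimg: "card (\<phi> ` e) = r" "card (\<phi> ` f) = r"
    using c inj by (auto simp: card_image inj_on_Un)
  have dimg: "\<phi> ` e \<inter> \<phi> ` f = {}"
    using inj disj by (metis image_empty inj_on_image_Int sup_ge1 sup_ge2)
  have ne: "\<phi> ` e \<noteq> {}" "\<phi> ` f \<noteq> {}" using cimg assms by (metis card.empty less_irrefl)+
  have "pattern r {\<phi> ` e, \<phi> ` f}"
    unfolding pattern_def ordered_matching_def partition_on_def disjoint_def
    using cimg dimg ne \<phi>(2) by (auto simp: card_insert_if)
  moreover have "follows s (r - 1) (elt (\<phi> ` e)) (elt (\<phi> ` f))"
  proof -
    have mono: "strict_mono_on e \<phi>" "strict_mono_on f \<phi>"
      using \<phi>(1) by (auto simp: strict_mono_on_def)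
    have "elt (\<phi> ` e) i < elt (\<phi> ` f) j \<longleftrightarrow> elt e i < elt f j" if "i < r" "j < r" for i j
      using that fin c strict_mono_on_less[OF \<phi>(1)] elt_strict_mono_image[OF fin(1) mono(1)]
        elt_strict_mono_image[OF fin(2) mono(2)] elt_in[of e i] elt_in[of f j] by simp
    then show ?thesis using fol assms unfolding follows_def by simp
  qed
  ultimately show ?thesis using that unfolding realizes_def by blast
qed

lemma realizes_collectable:
  assumes Q: "realizes r s Q" and "0 < r"
  shows "collectable r Q"
  unfolding collectable_def
proof (intro conjI allI impI)
  show "pattern r Q" using Q unfolding realizes_def by (rule conjunct1)
  fix k :: nat assume "2 \<le> k"
  let ?C = "model_edge s r k ` {..<k}"
  have ne: "model_edge s r k m \<noteq> {}" for m using assms(2) by (auto simp: model_edge_def)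
  have "inj_on (model_edge s r k) {..<k}"
  proof (rule inj_onI, rule ccontr)
    fix m m' assume "m \<in> {..<k}" "m' \<in> {..<k}" "model_edge s r k m = model_edge s r k m'" "m \<noteq> m'"
    then show False using model_edge_disjoint[of m k m' s r] ne[of m'] by simp
  qed
  then have "card ?C = k" by (simp add: card_image)
  moreover have "clique r Q ?C"
  proof (rule clique_if_follows[OF Q assms(2)])
    fix e f assume ef: "e \<in> ?C" "f \<in> ?C" "elt e 0 < elt f 0"
    then obtain m m' where m: "m < k" "m' < k" "e = model_edge s r k m" "f = model_edge s r k m'"
      by blast
    \<comment> \<open>Position 0 lies in block 0, which is upward, so edge \<open>m\<close> starts
      at \<open>m * r\<close>.\<close>
    then have "m < m'"
      using ef(3) assms(2) by (simp add: elt_model_edge model_point_def)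
    then show "follows s (r - 1) (elt e) (elt f)"
      unfolding m(3,4) using m(2) assms(2) by (intro follows_model_edge)
  next
    show "e \<inter> f = {}" if "e \<in> ?C" "f \<in> ?C" "e \<noteq> f" for e f
      using that model_edge_disjoint by blast
  qed (auto simp: finite_model_edge card_model_edge)
  ultimately show "\<exists>C :: nat set set. clique r Q C \<and> card C = k" by blast
qed

text \<open>The two edges of the pattern themselves form it, hence follow both codes, and
  comparisons determine a code.\<close>

lemma realizes_unique:
  assumes "realizes r s Q" "realizes r t Q" "0 < r" "k < r - 1"
  shows "s k = t k"
proof -
  obtain A B where Q: "Q = {A, B}" "A \<inter> B = {}" "finite A" "finite B" "card A = r" "card B = r"
    "follows s (r - 1) (elt A) (elt B)"
    using realizesE[OF assms(1)] by metis
  have "forms_pattern A B Q"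
    using realizes_forms_pattern[OF assms(1,3)] Q by simp
  moreover have "elt A 0 < elt B 0" using Q(7) unfolding follows_def by (simp add: code_less_def)
  ultimately have "follows t (r - 1) (elt A) (elt B)"
    using forms_pattern_follows[OF assms(2,3)] Q by simp
  then show ?thesis using follows_unique[OF Q(7)] assms(4) by blast
qed

section \<open>The last block and the maturity\<close>

lemma le_last_run_length:
  assumes "l \<le> length w" "\<And>i. i < l \<Longrightarrow> w ! (length w - 1 - i) = c"
  shows "l \<le> last_run_length w"
proof (cases "l = 0")
  case False
  then have "w \<noteq> []" using assms(1) by auto
  then have last: "last w = c" using assms(2)[of 0] False by (simp add: last_conv_nth)
  show ?thesis
  proof (rule ccontr)
    let ?n = "length (takeWhile (\<lambda>x. x = last w) (rev w))"
    assume "\<not> ?thesis"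
    then have n: "?n < l" by (simp add: last_run_length_def)
    then have "rev w ! ?n \<noteq> last w"
      using nth_length_takeWhile[of "\<lambda>x. x = last w" "rev w"] assms(1) by simp
    then show False using assms n last by (simp add: rev_nth)
  qed
qed simp

text \<open>The vertices of the trailing edge in the last block end the word, so the last run is at
  least that long. An inequality suffices, because a larger exponent only weakens the bound on the
  clique.\<close>

lemma realizes_maturity:
  assumes "realizes r s Q" "0 < r"
  shows "block_length s (r - 1) - 2 \<le> maturity Q"
proof -
  define l where "l = block_length s (r - 1)"
  obtain A B where Q: "Q = {A, B}" "A \<inter> B = {}" "finite A" "finite B" "card A = r" "card B = r"
    "A \<union> B = {1..2 * r}" and fol: "follows s (r - 1) (elt A) (elt B)"
    using realizesE[OF assms(1)] by metis
  \<comment> \<open>\<open>F\<close> is the trailing edge of the last block, whichever direction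
    that block has.\<close>
  define F G where "F = (if upward s (r - 1) then B else A)" and "G = (if upward s (r - 1) then A else B)"
  have FG: "Q = {F, G}" "F \<inter> G = {}" "finite F" "finite G" "card F = r" "card G = r"
    "F \<union> G = {1..2 * r}"
    using Q unfolding F_def G_def by auto
  have lr: "l \<le> r" using block_length_le[of s "r - 1"] assms(2) unfolding l_def by simp
  have above: "elt G j < elt F i" if i: "r - l \<le> i" "i < r" and j: "j < r" for i j
  proof -
    have bi: "block s i = block s (r - 1)"
      using block_eq_iff_block_length[of i "r - 1" s] i lr assms(2) unfolding l_def by simp
    have bj: "block s j \<le> block s (r - 1)" using j by (intro block_mono) simp
    have up: "upward s j = upward s (r - 1)" if "block s j = block s (r - 1)"
      using that upward_eq_if_block_eq by blast
    have upi: "upward s i = upward s (r - 1)" using bi upward_eq_if_block_eq by blast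
    show ?thesis
    proof (cases "upward s (r - 1)")
      case True
      then have "code_less s j i" using bi bj up unfolding code_less_def by auto
      then show ?thesis using True fol i j unfolding F_def G_def follows_def by simp
    next
      case False
      then have "\<not> code_less s i j" using bi bj upi unfolding code_less_def by auto
      then have "\<not> elt A i < elt B j" using fol i j unfolding follows_def by simp
      moreover have "elt A i \<noteq> elt B j"
        using elt_in[OF Q(3), of i] elt_in[OF Q(4), of j] Q i j by auto
      ultimately show ?thesis using False unfolding F_def G_def by auto
    qed
  qed
  have tail: "v \<in> F" if v: "2 * r - l < v" "v \<le> 2 * r" for v
  proof (rule ccontr)
    assume "v \<notin> F"
    moreover have "v \<in> F \<union> G" using v FG(7) by auto
    ultimately obtain j where j: "j < r" "v = elt G j" using elt_image[OF FG(4)] FG(6) by blast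
    \<comment> \<open>If one of the last \<open>l\<close> vertices belonged to \<open>G\<close>,
      then all \<open>l\<close> vertices of \<open>F\<close> in the last block would have to fit
      above it, where fewer than \<open>l\<close> places remain.\<close>
    have "elt F ` {r - l..<r} \<subseteq> {v<..2 * r}"
    proof
      fix w assume "w \<in> elt F ` {r - l..<r}"
      then obtain i where i: "r - l \<le> i" "i < r" "w = elt F i" by auto
      then have "w \<in> F \<union> G" using elt_in[OF FG(3), of i] FG(5) by auto
      then show "w \<in> {v<..2 * r}" using FG(7) above i j by auto
    qed
    then have "card (elt F ` {r - l..<r}) \<le> card {v<..2 * r}" by (intro card_mono) auto
    moreover have "card (elt F ` {r - l..<r}) = l"
      using lr FG(5) elt_inj_on[of F] by (subst card_image) (auto elim: inj_on_subset)
    ultimately show False using v by simp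
  qed
  have word: "matching_word Q = map (\<lambda>v. THE e. e \<in> Q \<and> v \<in> e) [1..<Suc (2 * r)]"
  proof -
    have "\<Union>Q = F \<union> G" using FG(1) by simp
    then have "\<Union>Q = {1..<Suc (2 * r)}" unfolding FG(7) atLeastLessThanSuc_atLeastAtMost .
    then show ?thesis unfolding matching_word_def by (simp del: upt_Suc)
  qed
  have "l \<le> last_run_length (matching_word Q)"
  proof (rule le_last_run_length[where c = F])
    show "l \<le> length (matching_word Q)" using lr by (simp add: word del: upt_Suc)
    fix i assume "i < l"
    then have "Suc (2 * r - Suc i) = 2 * r - i" using lr by simp
    then have "matching_word Q ! (length (matching_word Q) - 1 - i) =
        (THE e. e \<in> Q \<and> 2 * r - i \<in> e)"
      using lr \<open>i < l\<close> by (simp add: word del: upt_Suc)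
    also have "\<dots> = F"
    proof (rule the_equality)
      have "2 * r - i \<in> F" using tail[of "2 * r - i"] \<open>i < l\<close> lr by simp
      then show "F \<in> Q \<and> 2 * r - i \<in> F" "\<And>e. e \<in> Q \<and> 2 * r - i \<in> e \<Longrightarrow> e = F"
        using FG(1,2) by auto
    qed
    finally show "matching_word Q ! (length (matching_word Q) - 1 - i) = F" .
  qed
  then show ?thesis unfolding maturity_def l_def by simp
qed

section \<open>Application to ordered matchings\<close>

lemma vertex_array_matching:
  assumes "ordered_matching r V M" "0 < r"
  shows "vertex_array M elt r"
proof
  have part: "partition_on V M" and fin: "finite V" and c: "\<forall>e\<in>M. card e = r"
    using assms(1) unfolding ordered_matching_def by auto
  show "finite M" using finite_elements[OF fin part] .
  show "elt e i < elt e j" if "e \<in> M" "i < j" "j < r" for e i j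
    using that c elt_less[of i j e] by simp
  show "elt e i \<noteq> elt f j" if "e \<in> M" "f \<in> M" "e \<noteq> f" "i < r" "j < r" for e f i j
  proof -
    have "finite e" "finite f" using c that assms(2) by (auto intro: card_ge_0_finite)
    then have "elt e i \<in> e" "elt f j \<in> f" using c that by (auto intro: elt_in)
    moreover have "e \<inter> f = {}" using partition_onD2[OF part] that by (auto simp: disjoint_def)
    ultimately show ?thesis by auto
  qed
qed

theorem theorem1p3:
  fixes r n :: nat and P :: "nat \<Rightarrow> nat set set" and a :: "nat \<Rightarrow> nat"
  assumes "r \<ge> 2"
    and "bij_betw P {1..3 ^ (r - 1)} {Q. collectable r Q}"
    and "\<forall>i\<in>{1..3 ^ (r - 1)}. a i > 0"
    and "n \<ge> (\<Prod>i\<in>{1..3 ^ (r - 1)}. a i) + 1"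
  shows "(\<forall>(V :: 'a::linorder set) M. ordered_matching r V M \<and> card M = n \<longrightarrow>
           (\<exists>i\<in>{1..3 ^ (r - 1)}. \<exists>C\<subseteq>M. clique r (P i) C \<and>
              real (card C) > real (a i) / 2 ^ maturity (P i)))
       \<and> (\<forall>(V :: 'a set) M. ordered_matching r V M \<and> clean r M \<and> card M = n \<longrightarrow>
           (\<exists>i\<in>{1..3 ^ (r - 1)}. \<exists>C\<subseteq>M. clique r (P i) C \<and> card C \<ge> a i + 1))"
proof -
  let ?I = "{1..3 ^ (r - 1)} :: nat set"
  let ?S = "codes (r - 1)"
  have r: "0 < r" using assms(1) by simp
  have "\<forall>s. \<exists>Q. realizes r s Q" using realizes_exists[OF r] by blast
  from choice[OF this] obtain Q where Q: "realizes r s (Q s)" for s by blast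
  have inj: "inj_on Q ?S"
  proof (rule inj_onI)
    fix s t assume st: "s \<in> ?S" "t \<in> ?S" "Q s = Q t"
    have "s k = t k" if "k \<in> {..<r - 1}" for k
      using realizes_unique[OF Q[of s] _ r] Q[of t] st(3) that by simp
    then show "s = t" using st(1,2) unfolding codes_def by (intro PiE_ext)
  qed
  have fin: "finite {Q. collectable r Q}" and card: "card {Q. collectable r Q} = 3 ^ (r - 1)"
    using bij_betw_finite[OF assms(2)] bij_betw_same_card[OF assms(2)] by simp_all
  \<comment> \<open>Counting: the injective image of \<open>3 ^ (r - 1)\<close> codes lies in a set
    with equally many elements, so every collectable pattern realizes a code.\<close>
  have img: "Q ` ?S = {Q. collectable r Q}"
  proof (rule card_subset_eq[OF fin])
    show "Q ` ?S \<subseteq> {Q. collectable r Q}" using realizes_collectable[OF Q r] by blast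
    show "card (Q ` ?S) = card {Q. collectable r Q}"
      unfolding card card_image[OF inj] card_codes ..
  qed
  \<comment> \<open>The index in the given enumeration of the pattern realizing \<open>s\<close>; it
    transfers the weights \<open>a\<close> to codes.\<close>
  define g where "g s = the_inv_into ?I P (Q s)" for s
  have g: "bij_betw g ?S ?I"
    using bij_betw_trans[OF _ bij_betw_the_inv_into[OF assms(2)], of Q ?S] inj img
    by (simp add: bij_betw_def g_def[abs_def] comp_def)
  have gI: "g s \<in> ?I" if "s \<in> ?S" for s using bij_betwE[OF g] that by blast
  have Pg: "P (g s) = Q s" if "s \<in> ?S" for s
    unfolding g_def using assms(2) img that
    by (intro f_the_inv_into_f) (auto simp: bij_betw_def)
  have prod: "(\<Prod>s\<in>?S. real (a (g s))) < real n"
  proof -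
    have "(\<Prod>s\<in>?S. real (a (g s))) = real (\<Prod>i\<in>?I. a i)"
      using prod.reindex_bij_betw[OF g, of "\<lambda>i. real (a i)"] by simp
    then show ?thesis using assms(4) by linarith
  qed
  \<comment> \<open>Both claims come from here, with \<open>d = 2\<close> for (a) and
    \<open>d = 1\<close> for (b).\<close>
  have main: "\<exists>s\<in>?S. \<exists>C\<subseteq>M. clique r (P (g s)) C \<and>
      real (a (g s)) / d ^ (block_length s (r - 1) - 2) < real (card C)"
    if M: "ordered_matching r V M" "card M = n"
      and d: "d = 2 \<or> d = 1 \<and> clean r M" for V :: "'a set" and M and d :: real
  proof -
    interpret vertex_array M elt r using vertex_array_matching[OF M(1) r] .
    have edges: "card e = r" "finite e" if "e \<in> M" for e
    proof -
      show "card e = r" using M(1) that unfolding ordered_matching_def by blast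
      then show "finite e" using r by (intro card_ge_0_finite) simp
    qed
    have disj: "e \<inter> f = {}" if "e \<in> M" "f \<in> M" "e \<noteq> f" for e f
      using disjointD[of M] M(1) that unfolding ordered_matching_def partition_on_def by meson
    \<comment> \<open>In a clean matching each pair forms a collectable pattern, and by
      \<open>img\<close> that pattern has a code.\<close>
    have "\<exists>s. follows s (r - 1) (elt e) (elt f)"
      if cln: "clean r M" and ef: "e \<in> M" "f \<in> M" "elt e 0 < elt f 0" for e f
    proof -
      have "e \<noteq> f" using ef(3) by auto
      then obtain R where R: "collectable r R" "forms_pattern e f R"
        using cln ef unfolding clean_def by meson
      from R(1) have "R \<in> Q ` ?S" unfolding img by simp
      then obtain s where s: "R = Q s" by (rule imageE)
      have "follows s (r - 1) (elt e) (elt f)"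
        using forms_pattern_follows[OF Q r R(2)[unfolded s]] edges ef by simp
      then show ?thesis by blast
    qed
    then have d': "d = 2 \<or> d = 1 \<and>
        (\<forall>e\<in>M. \<forall>f\<in>M. elt e 0 < elt f 0 \<longrightarrow> (\<exists>s. follows s (r - 1) (elt e) (elt f)))"
      using d by blast
    obtain s C where s: "s \<in> ?S" and C: "C \<subseteq> M" "code_clique s (r - 1) C"
      and large: "real (a (g s)) / d ^ (block_length s (r - 1) - 2) < real (card C)"
      using large_code_clique[OF d', of "r - 1" "\<lambda>s. real (a (g s))"] r assms(3) gI prod M(2) by auto
    have "clique r (Q s) C"
    proof (rule clique_if_follows[OF Q r])
      show "finite C" using C(1) finite_M by (rule finite_subset)
      show "e \<inter> f = {}" if "e \<in> C" "f \<in> C" "e \<noteq> f" for e f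
        using that C(1) by (intro disj) auto
    qed (use C edges in \<open>auto simp: code_clique_def\<close>)
    then show ?thesis using s C(1) large Pg by auto
  qed
  show ?thesis
  proof (intro conjI allI impI; elim conjE)
    fix V :: "'a set" and M assume M: "ordered_matching r V M" "card M = n"
    obtain s C where s: "s \<in> ?S" and C: "C \<subseteq> M" "clique r (P (g s)) C"
      and large: "real (a (g s)) / 2 ^ (block_length s (r - 1) - 2) < real (card C)"
      using main[OF M, of 2] by auto
    have "block_length s (r - 1) - 2 \<le> maturity (P (g s))"
      using realizes_maturity[OF Q r] Pg[OF s] by simp
    then have "real (a (g s)) / 2 ^ maturity (P (g s)) \<le>
        real (a (g s)) / 2 ^ (block_length s (r - 1) - 2)"
      by (intro divide_left_mono) (auto intro: power_increasing)
    then show "\<exists>i\<in>?I. \<exists>C\<subseteq>M. clique r (P i) C \<and>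
        real (card C) > real (a i) / 2 ^ maturity (P i)"
      using gI[OF s] C large by (intro bexI[of _ "g s"] exI[of _ C]) auto
  next
    fix V :: "'a set" and M assume M: "ordered_matching r V M" "clean r M" "card M = n"
    obtain s C where "s \<in> ?S" "C \<subseteq> M" "clique r (P (g s)) C" "real (a (g s)) < real (card C)"
      using main[OF M(1,3), of 1] M(2) by auto
    then show "\<exists>i\<in>?I. \<exists>C\<subseteq>M. clique r (P i) C \<and> card C \<ge> a i + 1"
      using gI by (intro bexI[of _ "g s"] exI[of _ C]) auto
  qed
qed

end
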